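(* Let $X$ be a compact Hausdorff space and let $A$ be a unital $C(X)$-algebra all of whose fibres $A_x$, $x\in X$, are properly infinite. Then $M_n(A)$ is properly infinite for some natural number $n$.
   Context: A $C(X)$-algebra is a $C^*$-algebra $A$ together with a unital $*$-homomorphism from $C(X)$ into the center of the multiplier algebra of $A$. For $x\in X$, the fibre is $A_x=A/C_0(X\setminus\{x\})A$. A unital $C^*$-algebra is properly infinite if there are mutually orthogonal projections $e,f$ with $e\sim 1\sim f$ (Murray–von Neumann equivalence). *)

theory Defs
  imports "HOL-Analysis.Analysis"
begin

class cstar_algebra = real_normed_algebra_1 + banach +
  fixes scaleC :: "complex \<Rightarrow> 'a \<Rightarrow> 'a"
    and star :: "'a \<Rightarrow> 'a"
  assumes scaleC_of_real: "scaleC (complex_of_real r) x = scaleR r x"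
    and scaleC_add_right: "scaleC c (x + y) = scaleC c x + scaleC c y"
    and scaleC_add_left: "scaleC (c + d) x = scaleC c x + scaleC d x"
    and scaleC_scaleC: "scaleC c (scaleC d x) = scaleC (c * d) x"
    and scaleC_one: "scaleC 1 x = x"
    and norm_scaleC: "norm (scaleC c x) = cmod c * norm x"
    and scaleC_mult_left: "scaleC c x * y = scaleC c (x * y)"
    and scaleC_mult_right: "x * scaleC c y = scaleC c (x * y)"
    and star_add: "star (x + y) = star x + star y"
    and star_scaleC: "star (scaleC c x) = scaleC (cnj c) (star x)"
    and star_mult: "star (x * y) = star y * star x"
    and star_star: "star (star x) = x"
    and cstar_identity: "norm (star x * x) = norm x * norm x"

definition CX :: "('x::topological_space \<Rightarrow> complex) set" where
  "CX = {f. continuous_on UNIV f}"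

text \<open>A unital C(X)-algebra structure on a unital C*-algebra A: a unital
  *-homomorphism from C(X) into the centre of A (= centre of the multiplier
  algebra, since A is unital).\<close>
definition CX_algebra :: "(('x::topological_space \<Rightarrow> complex) \<Rightarrow> 'a::cstar_algebra) \<Rightarrow> bool" where
  "CX_algebra \<phi> \<longleftrightarrow>
     \<phi> (\<lambda>_. 1) = 1 \<and>
     (\<forall>f\<in>CX. \<forall>g\<in>CX. \<phi> (\<lambda>x. f x + g x) = \<phi> f + \<phi> g) \<and>
     (\<forall>f\<in>CX. \<forall>c. \<phi> (\<lambda>x. c * f x) = scaleC c (\<phi> f)) \<and>
     (\<forall>f\<in>CX. \<forall>g\<in>CX. \<phi> (\<lambda>x. f x * g x) = \<phi> f * \<phi> g) \<and>
     (\<forall>f\<in>CX. \<phi> (\<lambda>x. cnj (f x)) = star (\<phi> f)) \<and>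
     (\<forall>f\<in>CX. \<forall>a. \<phi> f * a = a * \<phi> f)"

text \<open>The ideal C_0(X minus {x}) A (closed linear span), whose quotient is the fibre A_x.\<close>
definition fibre_ideal :: "(('x::topological_space \<Rightarrow> complex) \<Rightarrow> 'a::cstar_algebra) \<Rightarrow> 'x \<Rightarrow> 'a set" where
  "fibre_ideal \<phi> x0 = closure (span {\<phi> f * a | f a. f \<in> CX \<and> f x0 = 0})"

text \<open>The quotient A/I is properly infinite: there are mutually orthogonal
  projections e, f in A/I that are Murray-von Neumann equivalent to 1.
  Elements of A/I are represented by elements of A, equality in A/I being
  congruence modulo I.\<close>
definition properly_infinite_quot :: "'a::cstar_algebra set \<Rightarrow> bool" where
  "properly_infinite_quot I \<longleftrightarrow>
     (\<exists>e f v w.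
        e * e - e \<in> I \<and> star e - e \<in> I \<and>
        f * f - f \<in> I \<and> star f - f \<in> I \<and>
        e * f \<in> I \<and>
        star v * v - 1 \<in> I \<and> v * star v - e \<in> I \<and>
        star w * w - 1 \<in> I \<and> w * star w - f \<in> I)"

definition fibre_properly_infinite :: "(('x::topological_space \<Rightarrow> complex) \<Rightarrow> 'a::cstar_algebra) \<Rightarrow> 'x \<Rightarrow> bool" where
  "fibre_properly_infinite \<phi> x = properly_infinite_quot (fibre_ideal \<phi> x)"

text \<open>n x n matrices over A, represented as functions nat => nat => 'a,
  only entries with indices < n being relevant.\<close>
definition mat_eq :: "nat \<Rightarrow> (nat \<Rightarrow> nat \<Rightarrow> 'a) \<Rightarrow> (nat \<Rightarrow> nat \<Rightarrow> 'a) \<Rightarrow> bool" where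
  "mat_eq n M N \<longleftrightarrow> (\<forall>i<n. \<forall>j<n. M i j = N i j)"

definition mat_mult :: "nat \<Rightarrow> (nat \<Rightarrow> nat \<Rightarrow> 'a::cstar_algebra) \<Rightarrow> (nat \<Rightarrow> nat \<Rightarrow> 'a) \<Rightarrow> nat \<Rightarrow> nat \<Rightarrow> 'a" where
  "mat_mult n M N = (\<lambda>i j. \<Sum>k<n. M i k * N k j)"

definition mat_star :: "(nat \<Rightarrow> nat \<Rightarrow> 'a::cstar_algebra) \<Rightarrow> nat \<Rightarrow> nat \<Rightarrow> 'a" where
  "mat_star M = (\<lambda>i j. star (M j i))"

definition mat_one :: "nat \<Rightarrow> nat \<Rightarrow> 'a::cstar_algebra" where
  "mat_one = (\<lambda>i j. if i = j then 1 else 0)"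

definition mat_zero :: "nat \<Rightarrow> nat \<Rightarrow> 'a::cstar_algebra" where
  "mat_zero = (\<lambda>i j. 0)"

definition mat_properly_infinite :: "nat \<Rightarrow> 'a::cstar_algebra itself \<Rightarrow> bool" where
  "mat_properly_infinite n _ \<longleftrightarrow>
     (\<exists>e f v w :: nat \<Rightarrow> nat \<Rightarrow> 'a.
        mat_eq n (mat_mult n e e) e \<and> mat_eq n (mat_star e) e \<and>
        mat_eq n (mat_mult n f f) f \<and> mat_eq n (mat_star f) f \<and>
        mat_eq n (mat_mult n e f) mat_zero \<and>
        mat_eq n (mat_mult n (mat_star v) v) mat_one \<and> mat_eq n (mat_mult n v (mat_star v)) e \<and>
        mat_eq n (mat_mult n (mat_star w) w) mat_one \<and> mat_eq n (mat_mult n w (mat_star w)) f)"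

end

theory Submission
  imports Defs
begin

text \<open>Each point has a neighbourhood on which the fibre isometries lift to exact isometries
  \<open>v\<close>, \<open>w\<close> with orthogonal ranges (normalise by an inverse square root, which is a power series since
  \<open>v\<^sup>* v\<close> is close to 1 there).  The rows \<open>(v\<^sup>j w)\<^sub>j\<close> are then local isometries of any length.
  If \<open>k\<close> such neighbourhoods cover the space and \<open>\<Sum>\<^sub>i p\<^sub>i\<^sup>2 = 1\<close> is a subordinate partition of unity,
  stacking the rows \<open>p\<^sub>i (v\<^sub>i\<^sup>j w\<^sub>i)\<^bsub>j < 2k\<^esub>\<close> gives a global isometry of size \<open>k \<times> 2k\<close>, whose two
  square halves are isometries in the \<open>k \<times> k\<close> matrices with orthogonal ranges.\<close>

section \<open>Elementary facts on C*-algebras\<close>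

lemma star_zero [simp]: "star (0::'a::cstar_algebra) = 0"
  using star_add[of 0 "0::'a"] by simp

lemma star_one [simp]: "star (1::'a::cstar_algebra) = 1"
  using star_mult[of "star 1" "1::'a"] by (simp add: star_star)

lemma star_scaleR: "star (scaleR r (x::'a::cstar_algebra)) = scaleR r (star x)"
  using star_scaleC[of "complex_of_real r" x] by (simp add: scaleC_of_real)

lemma star_minus: "star (- x::'a::cstar_algebra) = - star x"
  using star_scaleR[of "-1" x] by simp

lemma star_diff: "star (x - y::'a::cstar_algebra) = star x - star y"
  using star_add[of x "- y"] by (simp add: star_minus)

lemma star_power: "star (x ^ n) = star (x::'a::cstar_algebra) ^ n"
  by (induction n) (simp_all add: star_mult power_commutes)

lemma norm_le_norm_star: "norm x \<le> norm (star (x::'a::cstar_algebra))"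
proof (cases "x = 0")
  case False
  have "norm x * norm x \<le> norm (star x) * norm x"
    using norm_mult_ineq[of "star x" x] by (simp add: cstar_identity)
  then show ?thesis using False by simp
qed simp

lemma norm_star: "norm (star (x::'a::cstar_algebra)) = norm x"
  using norm_le_norm_star[of x] norm_le_norm_star[of "star x"] by (simp add: star_star)

lemma bounded_linear_star: "bounded_linear (star :: 'a::cstar_algebra \<Rightarrow> 'a)"
  by (rule bounded_linear_intro[where K = 1]) (simp_all add: star_add star_scaleR norm_star)

lemma norm_isometry: "star u * u = 1 \<Longrightarrow> norm (u::'a::cstar_algebra) = 1"
proof -
  assume "star u * u = 1"
  then have "norm u ^ 2 = 1" by (metis cstar_identity norm_one power2_eq_square)
  then show ?thesis by (simp add: power2_eq_1_iff) (use norm_ge_zero[of u] in linarith)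
qed

section \<open>Inverse square roots by power series\<close>

text \<open>These are the Taylor coefficients of \<open>(1 - z)\<close> to the power -1/2 at
  0.\<close>

definition inv_sqrt_coeff :: "nat \<Rightarrow> real" where
  "inv_sqrt_coeff n = (-1) ^ n * ((-1/2) gchoose n)"

text \<open>Each factor of the numerator has absolute value \<open>i + 1/2\<close>, at most
  \<open>i + 1\<close>, so the numerator is bounded by \<open>fact n\<close>. The bound lets the
  geometric series dominate the series in \<open>a\<close>.\<close>

lemma abs_inv_sqrt_coeff_le: "\<bar>inv_sqrt_coeff n\<bar> \<le> 1"
proof -
  have "(\<Prod>i = 0..<n. \<bar>- (1/2) - real i\<bar>) \<le> (\<Prod>i = 0..<n. real i + 1)"
    by (rule prod_mono) auto
  also have "\<dots> = fact n"
    by (simp add: fact_prod_Suc add.commute)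
  finally show ?thesis
    by (simp add: inv_sqrt_coeff_def abs_mult power_abs gbinomial_prod_rev abs_prod)
qed

text \<open>The square of the generating function is \<open>1 / (1 - z)\<close>, all of whose
  coefficients are 1. On coefficients this is the Vandermonde identity with both upper arguments
  -1/2.\<close>

lemma inv_sqrt_coeff_convolution: "(\<Sum>i\<le>n. inv_sqrt_coeff i * inv_sqrt_coeff (n - i)) = 1"
proof -
  have "(\<Sum>i\<le>n. inv_sqrt_coeff i * inv_sqrt_coeff (n - i))
      = (\<Sum>i\<le>n. (-1) ^ n * (((-1/2) gchoose i) * ((-1/2) gchoose (n - i))))"
  proof (intro sum.cong refl)
    fix i assume "i \<in> {..n}"
    then have "(-1 :: real) ^ n = (-1) ^ i * (-1) ^ (n - i)"
      by (simp flip: power_add)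
    then show "inv_sqrt_coeff i * inv_sqrt_coeff (n - i)
        = (-1) ^ n * (((-1/2) gchoose i) * ((-1/2) gchoose (n - i)))"
      by (simp only: inv_sqrt_coeff_def mult_ac)
  qed
  also have "\<dots> = (-1) ^ n * ((-1 :: real) gchoose n)"
    using gbinomial_Vandermonde[of "-1/2::real" "-1/2" n]
    by (simp add: sum_distrib_left[symmetric] atMost_atLeast0)
  also have "(-1 :: real) gchoose n = (-1) ^ n"
    using gbinomial_minus[of "1::real" n] by (simp add: binomial_gbinomial[symmetric])
  finally show ?thesis by (simp flip: power_mult_distrib)
qed

text \<open>The element \<open>t\<close> is the binomial series of \<open>1 - a\<close> to the power
  -1/2. It is self-adjoint because the coefficients are real, and its Cauchy square is the geometric
  series in \<open>a\<close>, the inverse of \<open>1 - a\<close>.\<close>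

lemma inverse_sqrt_exists:
  fixes a :: "'a::cstar_algebra"
  assumes "norm a < 1" and sa: "star a = a"
  obtains t where "star t = t" and "t * (1 - a) * t = 1"
proof -
  define F where "F n = scaleR (inv_sqrt_coeff n) (a ^ n)" for n
  define t where "t = suminf F"
  have geo: "summable (\<lambda>n. norm a ^ n)"
    using assms by (simp add: summable_geometric)
  have normF: "norm (F n) \<le> norm a ^ n" for n
    using mult_mono[OF abs_inv_sqrt_coeff_le[of n] norm_power_ineq[of a n]] by (simp add: F_def)
  have sF': "summable (\<lambda>n. norm (F n))"
    by (rule summable_comparison_test'[OF geo, of 0]) (use normF in auto)
  then have sF: "summable F" by (rule summable_norm_cancel)
  have spow: "summable (\<lambda>n. a ^ n)"
    by (rule summable_norm_cancel, rule summable_comparison_test'[OF geo, of 0])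
       (auto intro: norm_power_ineq)
  have "t * t = (\<Sum>n. \<Sum>i\<le>n. F i * F (n - i))"
    unfolding t_def by (rule Cauchy_product[OF sF' sF'])
  also have "(\<lambda>n. \<Sum>i\<le>n. F i * F (n - i)) = (\<lambda>n. a ^ n)"
  proof
    fix n
    have "(\<Sum>i\<le>n. F i * F (n - i)) = (\<Sum>i\<le>n. scaleR (inv_sqrt_coeff i * inv_sqrt_coeff (n - i)) (a ^ n))"
      by (intro sum.cong refl) (simp add: F_def power_add[symmetric])
    also have "\<dots> = a ^ n"
      by (simp add: scaleR_sum_left[symmetric] inv_sqrt_coeff_convolution)
    finally show "(\<Sum>i\<le>n. F i * F (n - i)) = a ^ n" .
  qed
  finally have tt: "t * t = (\<Sum>n. a ^ n)" .
  have "(\<Sum>n. a ^ n) = 1 + a * (\<Sum>n. a ^ n)"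
    using suminf_split_head[OF spow] suminf_mult[OF spow, of a] by simp
  then have "(1 - a) * (t * t) = 1"
    unfolding tt by (simp add: algebra_simps)
  moreover have "a * t = t * a"
    unfolding t_def suminf_mult[OF sF, symmetric] suminf_mult2[OF sF]
    by (simp add: F_def power_commutes)
  ultimately have "t * (1 - a) * t = 1"
    by (simp add: left_diff_distrib right_diff_distrib mult.assoc[symmetric])
  moreover have "star (F n) = F n" for n
    by (simp add: F_def star_scaleR star_power sa)
  then have "star t = t"
    unfolding t_def bounded_linear.suminf[OF bounded_linear_star sF] by simp
  ultimately show ?thesis using that by blast
qed

text \<open>Here the central self-adjoint element \<open>c\<close> localises: the relations between \<open>v\<close> and \<open>w\<close> are only
  required on its support.\<close>

lemma local_isometry_words:
  fixes c v w :: "'a::cstar_algebra"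
  assumes central: "\<And>a. c * a = a * c" and sc: "star c = c"
    and vv: "c * (star v * v) = c" and ww: "c * (star w * w) = c" and vw: "c * (star v * w) = 0"
  shows "c * (star (v ^ i * w) * (v ^ j * w)) = (if i = j then c else 0)"
proof -
  have move: "x * (c * y) * z = c * (x * y * z)" for x y z
    by (metis central mult.assoc)
  have swap: "c * star x = 0" if "c * x = 0" for x
    using arg_cong[OF that, of star] central[of "star x"] by (simp add: star_mult sc)
  have pow: "c * (star (v ^ n) * v ^ n) = c" for n
  proof (induction n)
    case (Suc n)
    have "c * (star (v ^ Suc n) * v ^ Suc n) = star (v ^ n) * (c * (star v * v)) * v ^ n"
      unfolding move power_Suc star_mult[of v] by (simp add: mult.assoc)
    then show ?case using Suc move[of "star (v ^ n)" 1 "v ^ n"] by (simp add: vv)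
  qed simp
  \<comment> \<open>The block \<open>star (v ^ i) * v ^ i\<close> collapses under \<open>c\<close>.
    What remains starts with \<open>star w * v\<close>, the adjoint of the vanishing
    \<open>star v * w\<close>.\<close>
  have off: "c * (star (v ^ i * w) * (v ^ j * w)) = 0" if "i < j" for i j
  proof -
    obtain d where d: "j = i + Suc d" using \<open>i < j\<close> less_imp_Suc_add by force
    have "v ^ j = v ^ i * (v * v ^ d)"
      unfolding d by (simp only: power_add power_Suc)
    then have "c * (star (v ^ i * w) * (v ^ j * w))
        = star w * (c * (star (v ^ i) * v ^ i)) * (v * v ^ d * w)"
      unfolding move star_mult[of _ w] by (simp add: mult.assoc)
    also have "\<dots> = c * star (star v * w) * (v ^ d * w)"
      using move[of "star w" 1 "v * v ^ d * w"] by (simp add: pow star_mult star_star mult.assoc)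
    finally show ?thesis using swap[OF vw] by simp
  qed
  consider "i = j" | "i < j" | "j < i" by linarith
  then show ?thesis
  proof cases
    case 1
    have "c * (star (v ^ i * w) * (v ^ i * w)) = star w * (c * (star (v ^ i) * v ^ i)) * w"
      unfolding move star_mult[of _ w] by (simp add: mult.assoc)
    also have "\<dots> = c" using move[of "star w" 1 w] by (simp add: pow ww)
    finally show ?thesis using 1 by simp
  next
    case 2
    then show ?thesis using off by simp
  next
    case 3
    \<comment> \<open>This case is the adjoint of the one with the exponents exchanged.\<close>
    then show ?thesis using swap[OF off[OF 3]] by (simp add: star_mult star_star mult.assoc)
  qed
qed

section \<open>Localisation in a C(X)-algebra\<close>

locale CX_alg =
  fixes \<phi> :: "('x::topological_space \<Rightarrow> complex) \<Rightarrow> 'a::cstar_algebra"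
  assumes CX_algebra: "CX_algebra \<phi>"
begin

definition \<psi> :: "('x \<Rightarrow> real) \<Rightarrow> 'a" where
  "\<psi> r = \<phi> (\<lambda>x. complex_of_real (r x))"

lemma of_real_CX: "continuous_on UNIV r \<Longrightarrow> (\<lambda>x. complex_of_real (r x)) \<in> CX"
  by (simp add: CX_def continuous_on_of_real)

lemma phi_one: "\<phi> (\<lambda>_. 1) = 1"
  and phi_add: "f \<in> CX \<Longrightarrow> g \<in> CX \<Longrightarrow> \<phi> (\<lambda>x. f x + g x) = \<phi> f + \<phi> g"
  and phi_scale: "f \<in> CX \<Longrightarrow> \<phi> (\<lambda>x. c * f x) = scaleC c (\<phi> f)"
  and phi_mult: "f \<in> CX \<Longrightarrow> g \<in> CX \<Longrightarrow> \<phi> (\<lambda>x. f x * g x) = \<phi> f * \<phi> g"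
  and phi_cnj: "f \<in> CX \<Longrightarrow> \<phi> (\<lambda>x. cnj (f x)) = star (\<phi> f)"
  and phi_central: "f \<in> CX \<Longrightarrow> \<phi> f * a = a * \<phi> f"
  using CX_algebra unfolding CX_algebra_def by blast+

lemma psi_one: "\<psi> (\<lambda>_. 1) = 1"
  by (simp add: \<psi>_def phi_one)

lemma psi_add: "continuous_on UNIV r \<Longrightarrow> continuous_on UNIV s \<Longrightarrow> \<psi> (\<lambda>x. r x + s x) = \<psi> r + \<psi> s"
  by (simp add: \<psi>_def phi_add of_real_CX)

lemma psi_mult: "continuous_on UNIV r \<Longrightarrow> continuous_on UNIV s \<Longrightarrow> \<psi> (\<lambda>x. r x * s x) = \<psi> r * \<psi> s"
  by (simp add: \<psi>_def phi_mult of_real_CX)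

lemma psi_scale: "continuous_on UNIV r \<Longrightarrow> \<psi> (\<lambda>x. c * r x) = scaleR c (\<psi> r)"
  using phi_scale[of "\<lambda>x. complex_of_real (r x)" "complex_of_real c"]
  by (simp add: \<psi>_def of_real_CX scaleC_of_real)

lemma star_psi: "continuous_on UNIV r \<Longrightarrow> star (\<psi> r) = \<psi> r"
  using phi_cnj[of "\<lambda>x. complex_of_real (r x)"] by (simp add: \<psi>_def of_real_CX)

lemma psi_central: "continuous_on UNIV r \<Longrightarrow> \<psi> r * a = a * \<psi> r"
  by (simp add: \<psi>_def phi_central of_real_CX)

lemma psi_left_commute: "continuous_on UNIV r \<Longrightarrow> a * (\<psi> r * b) = \<psi> r * (a * b)"
  by (metis psi_central mult.assoc)

lemma star_psi_mult_psi:
  assumes r: "continuous_on UNIV r"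
  shows "star (\<psi> r * a) * (\<psi> r * b) = \<psi> r * \<psi> r * (star a * b)"
proof -
  have "star (\<psi> r * a) = \<psi> r * star a"
    by (simp add: star_mult star_psi[OF r] psi_central[OF r])
  then show ?thesis
    by (simp add: mult.assoc psi_left_commute[OF r, of "star a" b])
qed

lemma psi_sum:
  "finite I \<Longrightarrow> (\<And>i. i \<in> I \<Longrightarrow> continuous_on UNIV (r i)) \<Longrightarrow> \<psi> (\<lambda>x. \<Sum>i\<in>I. r i x) = (\<Sum>i\<in>I. \<psi> (r i))"
proof (induction I rule: finite_induct)
  case empty
  show ?case using psi_scale[of "\<lambda>_. 1" 0] by simp
next
  case (insert i I)
  then show ?case by (simp add: psi_add continuous_on_sum)
qed

text \<open>A real function with values in \<open>[-1, 1]\<close> is the mean of the unimodular functions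
  \<open>r \<plusminus> \<i> \<surd>(1 - r\<^sup>2)\<close>, which \<open>\<phi>\<close> maps to unitaries.\<close>

lemma norm_psi_le_1:
  assumes r: "continuous_on UNIV r" and le: "\<And>x. \<bar>r x\<bar> \<le> 1"
  shows "norm (\<psi> r) \<le> 1"
proof -
  define u where "u x = Complex (r x) (sqrt (1 - (r x)\<^sup>2))" for x
  have "continuous_on UNIV u"
    unfolding u_def Complex_eq by (intro continuous_intros r)
  then have u: "u \<in> CX" "(\<lambda>x. cnj (u x)) \<in> CX"
    by (auto simp: CX_def intro: continuous_intros)
  have "cnj (u x) * u x = 1" for x
  proof -
    have "(r x)\<^sup>2 \<le> 1" using le[of x] by (simp add: abs_square_le_1)
    then show ?thesis
      by (simp add: u_def complex_eq_iff power2_eq_square[symmetric])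
  qed
  then have "star (\<phi> u) * \<phi> u = 1"
    using phi_mult[OF u(2,1)] phi_cnj[OF u(1)] by (simp add: phi_one)
  then have n: "norm (\<phi> u) = 1" by (rule norm_isometry)
  have "(\<lambda>x. u x + cnj (u x)) = (\<lambda>x. complex_of_real (2 * r x))"
    by (auto simp: u_def complex_eq_iff)
  then have "\<phi> u + star (\<phi> u) = \<psi> (\<lambda>x. 2 * r x)"
    using phi_add[OF u] phi_cnj[OF u(1)] by (simp add: \<psi>_def)
  also have "\<dots> = scaleR 2 (\<psi> r)" by (rule psi_scale[OF r])
  finally have "2 * norm (\<psi> r) = norm (\<phi> u + star (\<phi> u))" by simp
  also have "\<dots> \<le> 2" using norm_triangle_ineq[of "\<phi> u" "star (\<phi> u)"] n by (simp add: norm_star)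
  finally show ?thesis by simp
qed

lemma norm_psi_le:
  assumes r: "continuous_on UNIV r" and le: "\<And>x. \<bar>r x\<bar> \<le> C" and "C > 0"
  shows "norm (\<psi> r) \<le> C"
proof -
  have "norm (\<psi> (\<lambda>x. inverse C * r x)) \<le> 1"
    using le \<open>C > 0\<close> by (intro norm_psi_le_1 continuous_intros r) (simp add: abs_mult field_simps)
  then have "inverse C * norm (\<psi> r) \<le> 1"
    unfolding psi_scale[OF r] using \<open>C > 0\<close> by simp
  then show ?thesis using \<open>C > 0\<close> by (simp add: field_simps)
qed

text \<open>The factor 2 comes from estimating the real and imaginary parts separately.\<close>

lemma norm_phi_le:
  assumes f: "f \<in> CX" and le: "\<And>x. cmod (f x) \<le> C" and "C > 0"
  shows "norm (\<phi> f) \<le> 2 * C"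
proof -
  have c: "continuous_on UNIV (\<lambda>x. Re (f x))" "continuous_on UNIV (\<lambda>x. Im (f x))"
    using f by (auto simp: CX_def intro: continuous_intros)
  have iCX: "(\<lambda>x. \<i> * complex_of_real (Im (f x))) \<in> CX"
    using c(2) by (auto simp: CX_def intro!: continuous_intros)
  have "\<phi> f = \<phi> (\<lambda>x. complex_of_real (Re (f x)) + \<i> * complex_of_real (Im (f x)))"
    by (simp add: complex_eq[symmetric])
  also have "\<dots> = \<psi> (\<lambda>x. Re (f x)) + scaleC \<i> (\<psi> (\<lambda>x. Im (f x)))"
    by (simp add: phi_add[OF of_real_CX[OF c(1)] iCX] phi_scale[OF of_real_CX[OF c(2)]] \<psi>_def)
  finally have "norm (\<phi> f) \<le> norm (\<psi> (\<lambda>x. Re (f x))) + norm (\<psi> (\<lambda>x. Im (f x)))"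
    by (metis norm_triangle_ineq norm_scaleC norm_ii mult_1)
  moreover have "norm (\<psi> (\<lambda>x. Re (f x))) \<le> C" "norm (\<psi> (\<lambda>x. Im (f x))) \<le> C"
    by (rule norm_psi_le; use c le \<open>C > 0\<close> abs_Re_le_cmod abs_Im_le_cmod order_trans in blast)+
  ultimately show ?thesis by simp
qed

section \<open>Elements vanishing at a point\<close>

definition cutoff :: "'x \<Rightarrow> ('x \<Rightarrow> real) \<Rightarrow> bool" where
  "cutoff x r \<longleftrightarrow> continuous_on UNIV r \<and> (\<forall>y. 0 \<le> r y \<and> r y \<le> 1) \<and> r x = 1"

lemma cutoff_mult: "cutoff x r \<Longrightarrow> cutoff x s \<Longrightarrow> cutoff x (\<lambda>y. r y * s y)"
  by (auto simp: cutoff_def mult_le_one intro: continuous_intros)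

lemma norm_psi_cutoff: "cutoff x r \<Longrightarrow> norm (\<psi> r * a) \<le> norm a"
proof -
  assume "cutoff x r"
  then have "norm (\<psi> r) \<le> 1" by (intro norm_psi_le_1) (auto simp: cutoff_def)
  then show ?thesis
    using norm_mult_ineq[of "\<psi> r" a] mult_right_mono[of "norm (\<psi> r)" 1 "norm a"] by simp
qed

text \<open>This is the form in which congruence modulo the fibre ideal is used: multiplication by a
  suitable cutoff at \<open>x\<close> makes the element arbitrarily small in norm.\<close>

definition null_at :: "'x \<Rightarrow> 'a set" where
  "null_at x = {a. \<forall>\<epsilon>>0. \<exists>r. cutoff x r \<and> norm (\<psi> r * a) < \<epsilon>}"

lemma null_atE:
  assumes "a \<in> null_at x" "\<epsilon> > 0"
  obtains r where "cutoff x r" "norm (\<psi> r * a) < \<epsilon>"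
  using assms unfolding null_at_def by blast

text \<open>The product of the two cutoffs works for the sum, since each cutoff acts contractively
  on the summand controlled by the other.\<close>

lemma null_at_add:
  assumes "a \<in> null_at x" "b \<in> null_at x"
  shows "a + b \<in> null_at x"
  unfolding null_at_def mem_Collect_eq
proof (intro allI impI)
  fix \<epsilon> :: real assume "\<epsilon> > 0"
  then obtain r s where r: "cutoff x r" "norm (\<psi> r * a) < \<epsilon>/2" and s: "cutoff x s" "norm (\<psi> s * b) < \<epsilon>/2"
    using null_atE[OF assms(1)] null_atE[OF assms(2)] half_gt_zero by metis
  have c: "continuous_on UNIV r" "continuous_on UNIV s" using r s by (auto simp: cutoff_def)
  have "\<psi> (\<lambda>y. r y * s y) * (a + b) = \<psi> s * (\<psi> r * a) + \<psi> r * (\<psi> s * b)"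
    using psi_left_commute[OF c(1), of "\<psi> s" a] by (simp add: psi_mult[OF c] distrib_left mult.assoc)
  then have "norm (\<psi> (\<lambda>y. r y * s y) * (a + b)) \<le> norm (\<psi> r * a) + norm (\<psi> s * b)"
    using norm_psi_cutoff[OF s(1), of "\<psi> r * a"] norm_psi_cutoff[OF r(1), of "\<psi> s * b"]
    by (metis norm_triangle_mono)
  then show "\<exists>r. cutoff x r \<and> norm (\<psi> r * (a + b)) < \<epsilon>"
    using cutoff_mult[OF r(1) s(1)] r(2) s(2) by fastforce
qed

lemma null_at_lmult:
  assumes "a \<in> null_at x"
  shows "b * a \<in> null_at x"
  unfolding null_at_def mem_Collect_eq
proof (intro allI impI)
  fix \<epsilon> :: real assume "\<epsilon> > 0"
  then have "\<epsilon> / (norm b + 1) > 0" by (simp add: add_nonneg_pos)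
  then obtain r where r: "cutoff x r" "norm (\<psi> r * a) < \<epsilon> / (norm b + 1)"
    using null_atE[OF assms] by blast
  have "norm (\<psi> r * (b * a)) = norm (b * (\<psi> r * a))"
    using r(1) by (simp add: psi_left_commute cutoff_def)
  also have "\<dots> \<le> (norm b + 1) * norm (\<psi> r * a)"
    by (rule order_trans[OF norm_mult_ineq]) (simp add: mult_right_mono)
  also have "\<dots> < \<epsilon>"
    using r(2) by (simp add: pos_less_divide_eq add_nonneg_pos mult.commute)
  finally show "\<exists>r. cutoff x r \<and> norm (\<psi> r * (b * a)) < \<epsilon>" using r(1) by blast
qed

lemma null_at_star:
  assumes "a \<in> null_at x"
  shows "star a \<in> null_at x"
proof -
  have "norm (\<psi> r * star a) = norm (\<psi> r * a)" if "cutoff x r" for r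
    using that norm_star[of "\<psi> r * a"]
    by (simp add: star_mult star_psi psi_central cutoff_def)
  then show ?thesis using assms unfolding null_at_def by force
qed

lemma null_at_rmult: "a \<in> null_at x \<Longrightarrow> a * b \<in> null_at x"
  using null_at_star[OF null_at_lmult[OF null_at_star, of a x "star b"]] by (simp add: star_mult star_star)

lemma null_at_diff: "a \<in> null_at x \<Longrightarrow> b \<in> null_at x \<Longrightarrow> a - b \<in> null_at x"
  using null_at_add[of a x "-1 * b"] null_at_lmult[of b x "-1"] by simp

lemma null_at_generator:
  assumes f: "f \<in> CX" and "f x = 0"
  shows "\<phi> f \<in> null_at x"
  unfolding null_at_def mem_Collect_eq
proof (intro allI impI)
  fix \<epsilon> :: real assume "\<epsilon> > 0"
  \<comment> \<open>The estimate through \<open>norm_phi_le\<close> yields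
    \<open>2 * \<delta>\<close>, which has to be strictly below \<open>\<epsilon>\<close>.\<close>
  define \<delta> where "\<delta> = \<epsilon> / 3"
  have d: "\<delta> > 0" using \<open>\<epsilon> > 0\<close> by (simp add: \<delta>_def)
  \<comment> \<open>A tent in \<open>cmod (f y)\<close>: it equals 1 at \<open>x\<close>, where
    \<open>f\<close> vanishes, and is 0 wherever \<open>cmod (f y)\<close> is at least
    \<open>\<delta>\<close>.\<close>
  define r where "r y = max 0 (1 - cmod (f y) / \<delta>)" for y
  have cr: "cutoff x r"
    using f \<open>f x = 0\<close> d by (auto simp: cutoff_def r_def CX_def intro!: continuous_intros)
  have "cmod (complex_of_real (r y) * f y) \<le> \<delta>" for y
  proof (cases "cmod (f y) < \<delta>")
    case True
    have "r y * cmod (f y) \<le> 1 * \<delta>"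
      using cr True by (intro mult_mono) (auto simp: cutoff_def)
    then show ?thesis using cr by (simp add: norm_mult cutoff_def)
  next
    case False
    then have "r y = 0" using d by (simp add: r_def field_simps)
    then show ?thesis using d by simp
  qed
  moreover have rC: "(\<lambda>x. complex_of_real (r x)) \<in> CX" using cr by (simp add: of_real_CX cutoff_def)
  moreover have "(\<lambda>y. complex_of_real (r y) * f y) \<in> CX"
    using rC f by (auto simp: CX_def intro: continuous_intros)
  ultimately have "norm (\<psi> r * \<phi> f) \<le> 2 * \<delta>"
    using norm_phi_le[of "\<lambda>y. complex_of_real (r y) * f y" \<delta>] f d by (simp add: \<psi>_def phi_mult)
  then show "\<exists>r. cutoff x r \<and> norm (\<psi> r * \<phi> f) < \<epsilon>"
    using cr \<open>\<epsilon> > 0\<close> by (auto simp: \<delta>_def)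
qed

text \<open>A cutoff that works for a nearby element also works for the limit, as cutoffs do not
  increase the norm of the difference.\<close>

lemma closed_null_at: "closed (null_at x)"
proof -
  have "a \<in> null_at x" if "a \<in> closure (null_at x)" for a
    unfolding null_at_def mem_Collect_eq
  proof (intro allI impI)
    fix \<epsilon> :: real assume "\<epsilon> > 0"
    then obtain b where b: "b \<in> null_at x" "dist b a < \<epsilon>/2"
      using \<open>a \<in> closure _\<close> by (meson closure_approachable half_gt_zero)
    then obtain r where r: "cutoff x r" "norm (\<psi> r * b) < \<epsilon>/2"
      using null_atE[OF b(1) half_gt_zero[OF \<open>\<epsilon> > 0\<close>]] by blast
    have "norm (\<psi> r * a) \<le> norm (\<psi> r * b) + norm (\<psi> r * (a - b))"
      using norm_triangle_ineq[of "\<psi> r * b" "\<psi> r * (a - b)"] by (simp add: right_diff_distrib)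
    also have "\<dots> < \<epsilon>"
      using norm_psi_cutoff[OF r(1), of "a - b"] r(2) b(2) by (simp add: dist_norm norm_minus_commute)
    finally show "\<exists>r. cutoff x r \<and> norm (\<psi> r * a) < \<epsilon>" using r(1) by blast
  qed
  then show ?thesis using closure_subset_eq by blast
qed

lemma fibre_ideal_subset: "fibre_ideal \<phi> x \<subseteq> null_at x"
proof -
  have zero: "(0::'a) \<in> null_at x"
    using null_at_lmult[OF null_at_generator[of "\<lambda>_. 0" x], of 0] by (simp add: CX_def)
  have "scaleR c a \<in> null_at x" if "a \<in> null_at x" for c a
    using null_at_lmult[OF that, of "scaleR c 1"] by simp
  then have "subspace (null_at x)"
    by (simp add: subspace_def zero null_at_add)
  then show ?thesis
    unfolding fibre_ideal_def
    by (intro closure_minimal span_minimal closed_null_at) (auto intro: null_at_generator null_at_rmult)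
qed

section \<open>Exact isometries near a point\<close>

text \<open>The defect \<open>1 - star v * v\<close> is small only near \<open>x\<close>.
  Multiplying it by a central function equal to 1 on the support of \<open>h\<close> gives an
  element \<open>a\<close> that is small in all of \<open>A\<close>, so \<open>1 - a\<close> has an
  inverse square root \<open>t\<close>. Under \<open>h\<close> the elements \<open>1 - a\<close> and
  \<open>star v * v\<close> agree, so \<open>v * t\<close> is isometric there.\<close>

lemma local_normalisation:
  assumes "star v * v - 1 \<in> null_at x"
  obtains h t where "cutoff x h" and "\<psi> h * (star (v * t) * (v * t)) = \<psi> h"
proof -
  obtain g where g: "cutoff x g" "norm (\<psi> g * (star v * v - 1)) < 1/4"
    using null_atE[OF assms, of "1/4"] by auto
  have cg: "continuous_on UNIV g" using g(1) by (simp add: cutoff_def)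
  \<comment> \<open>\<open>h\<close> is nonzero only where \<open>g\<close> exceeds 1/2. There
    \<open>q\<close> equals \<open>1 / g\<close>, so that \<open>q * g\<close> is 1, while
    truncating the denominator at 1/2 keeps \<open>q\<close> bounded by 2 everywhere. With the bound
    1/4 above this gives norm at most 1/2 for \<open>a\<close>.\<close>
  define h where "h y = max 0 (2 * g y - 1)" for y
  define q where "q y = 1 / max (g y) (1/2)" for y
  have ch: "continuous_on UNIV h" unfolding h_def by (intro continuous_intros cg)
  have cq: "continuous_on UNIV q"
    unfolding q_def by (intro continuous_intros cg) (auto simp: max_def)
  have hc: "cutoff x h" using g(1) ch by (auto simp: cutoff_def h_def)
  have nq: "norm (\<psi> q) \<le> 2"
    by (rule norm_psi_le[OF cq]) (auto simp: q_def max_def field_simps)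
  define a where "a = \<psi> (\<lambda>y. q y * g y) * (1 - star v * v)"
  have cqg: "continuous_on UNIV (\<lambda>y. q y * g y)" by (intro continuous_intros cq cg)
  have "norm a = norm (\<psi> q * (\<psi> g * (star v * v - 1)))"
    unfolding a_def psi_mult[OF cq cg]
    by (simp add: mult.assoc right_diff_distrib norm_minus_commute)
  also have "\<dots> \<le> norm (\<psi> q) * norm (\<psi> g * (star v * v - 1))" by (rule norm_mult_ineq)
  also have "\<dots> \<le> 2 * (1/4)" using nq g(2) by (intro mult_mono) auto
  finally have "norm a < 1" by simp
  moreover have "star a = a"
    by (simp add: a_def star_mult star_psi[OF cqg] psi_central[OF cqg] star_diff star_star)
  ultimately obtain t where t: "star t = t" "t * (1 - a) * t = 1"
    by (rule inverse_sqrt_exists)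
  have "(\<lambda>y. h y * (q y * g y)) = h"
    by (auto simp: h_def q_def max_def)
  then have "\<psi> h * \<psi> (\<lambda>y. q y * g y) = \<psi> h" using psi_mult[OF ch cqg] by simp
  then have "\<psi> h * a = \<psi> h * (1 - star v * v)"
    by (simp add: a_def flip: mult.assoc)
  then have e: "\<psi> h * (star v * v) = \<psi> h * (1 - a)" by (simp add: algebra_simps)
  have "\<psi> h * (star (v * t) * (v * t)) = t * (\<psi> h * (star v * v)) * t"
    by (simp add: star_mult t psi_left_commute[OF ch] mult.assoc)
  also have "\<dots> = \<psi> h * (t * (1 - a) * t)"
    unfolding e by (simp add: psi_left_commute[OF ch] mult.assoc)
  finally have "\<psi> h * (star (v * t) * (v * t)) = \<psi> h" by (simp add: t)
  then show ?thesis using that hc by blast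
qed

text \<open>First \<open>v\<close> is made isometric near \<open>x\<close>; then the component of
  \<open>w\<close> in its range is removed, and only then is the result normalised. Normalisation
  multiplies on the right, so the orthogonality already gained survives it.\<close>

lemma local_isometries:
  assumes "fibre_properly_infinite \<phi> x"
  obtains h v w where "cutoff x h" and "\<psi> h * (star v * v) = \<psi> h" and "\<psi> h * (star w * w) = \<psi> h"
    and "\<psi> h * (star v * w) = 0"
proof -
  let ?N = "null_at x"
  obtain e f v w where N: "e * f \<in> ?N" "star v * v - 1 \<in> ?N" "v * star v - e \<in> ?N"
      "star w * w - 1 \<in> ?N" "w * star w - f \<in> ?N"
    using assms fibre_ideal_subset[of x]
    unfolding fibre_properly_infinite_def properly_infinite_quot_def by blast
  \<comment> \<open>Modulo null elements the two range projections are \<open>e\<close> and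
    \<open>f\<close>, whose product is null.\<close>
  have "(v * star v) * (w * star w) = (v * star v - e) * (w * star w) + e * (w * star w - f) + e * f"
    by (simp add: algebra_simps)
  then have "(v * star v) * (w * star w) \<in> ?N"
    using N by (simp add: null_at_add null_at_rmult null_at_lmult)
  then have "star v * ((v * star v) * (w * star w)) * w \<in> ?N"
    by (simp add: null_at_rmult null_at_lmult)
  \<comment> \<open>Compressing that product by \<open>star v\<close> and \<open>w\<close> gives
    \<open>(star v * v) * (star v * w) * (star w * w)\<close>, and the outer factors are 1 modulo
    null elements.\<close>
  moreover have "star v * w = star v * ((v * star v) * (w * star w)) * w
      - (star v * v - 1) * (star v * w) - (star v * v * (star v * w)) * (star w * w - 1)"
    by (simp add: algebra_simps)
  ultimately have vw: "star v * w \<in> ?N"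
    using N by (metis null_at_diff null_at_rmult null_at_lmult)
  obtain h t where h: "cutoff x h" "\<psi> h * (star (v * t) * (v * t)) = \<psi> h"
    using local_normalisation[OF N(2)] by blast
  define v' where "v' = v * t"
  have v'w: "star v' * w \<in> ?N"
    using null_at_lmult[OF vw, of "star t"] by (simp add: v'_def star_mult mult.assoc)
  \<comment> \<open>A Gram-Schmidt step: where \<open>v'\<close> is exactly isometric,
    \<open>star v' * w1\<close> vanishes exactly. The correction is null at \<open>x\<close>, so
    \<open>w1\<close> remains isometric modulo null elements.\<close>
  define w1 where "w1 = w - v' * (star v' * w)"
  have dw: "w1 - w \<in> ?N"
    using null_at_lmult[OF v'w, of "- v'"] by (simp add: w1_def)
  have "star w1 * w1 - 1 = star w1 * (w1 - w) + star (w1 - w) * w + (star w * w - 1)"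
    by (simp add: algebra_simps star_diff)
  moreover have "star w1 * (w1 - w) + star (w1 - w) * w + (star w * w - 1) \<in> ?N"
    using N dw by (intro null_at_add null_at_lmult[of "w1 - w"] null_at_rmult null_at_star)
  ultimately have "star w1 * w1 - 1 \<in> ?N" by (simp only:)
  then obtain k s where k: "cutoff x k" "\<psi> k * (star (w1 * s) * (w1 * s)) = \<psi> k"
    using local_normalisation by blast
  have ch: "continuous_on UNIV h" "continuous_on UNIV k" using h k by (auto simp: cutoff_def)
  have hk: "\<psi> (\<lambda>y. h y * k y) = \<psi> h * \<psi> k" using ch by (rule psi_mult)
  have kh: "\<psi> h * \<psi> k = \<psi> k * \<psi> h" by (rule psi_central[OF ch(1)])
  have "\<psi> h * (star v' * w1) = \<psi> h * (star v' * w) - (\<psi> h * (star v' * v')) * (star v' * w)"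
    by (simp add: w1_def algebra_simps)
  also have "\<dots> = 0" using h(2) by (simp add: v'_def mult.assoc)
  finally have 0: "\<psi> h * (star v' * w1) = 0" .
  show ?thesis
  proof (rule that[of "\<lambda>y. h y * k y" v' "w1 * s"])
    show "cutoff x (\<lambda>y. h y * k y)" using h k by (simp add: cutoff_mult)
    show "\<psi> (\<lambda>y. h y * k y) * (star v' * v') = \<psi> (\<lambda>y. h y * k y)"
      unfolding hk kh using h(2) by (simp add: v'_def mult.assoc)
    show "\<psi> (\<lambda>y. h y * k y) * (star (w1 * s) * (w1 * s)) = \<psi> (\<lambda>y. h y * k y)"
      unfolding hk using k(2) by (simp add: mult.assoc)
    have "\<psi> (\<lambda>y. h y * k y) * (star v' * (w1 * s)) = \<psi> k * (\<psi> h * (star v' * w1)) * s"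
      unfolding hk kh by (simp add: mult.assoc)
    then show "\<psi> (\<lambda>y. h y * k y) * (star v' * (w1 * s)) = 0" unfolding 0 by simp
  qed
qed

section \<open>Gluing over a finite cover\<close>

text \<open>The number of rows is the size of a finite subcover, while the column index
  \<open>j\<close> is unbounded: the columns form an infinite orthonormal family of vectors of
  length \<open>k\<close> over \<open>A\<close>.\<close>

lemma global_isometry:
  assumes "compact (UNIV :: 'x set)" and "\<forall>x. fibre_properly_infinite \<phi> x"
  obtains k :: nat and W :: "nat \<Rightarrow> nat \<Rightarrow> 'a" where "k \<ge> 1"
    and "\<And>i j. (\<Sum>l<k. star (W l i) * W l j) = (if i = j then 1 else 0)"
proof -
  have "\<exists>h v w. cutoff x h \<and> \<psi> h * (star v * v) = \<psi> h \<and> \<psi> h * (star w * w) = \<psi> h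
      \<and> \<psi> h * (star v * w) = 0" for x
    using local_isometries[of x] assms(2) by metis
  then obtain h v w where h: "\<And>x. cutoff x (h x)" and vv: "\<And>x. \<psi> (h x) * (star (v x) * v x) = \<psi> (h x)"
    and ww: "\<And>x. \<psi> (h x) * (star (w x) * w x) = \<psi> (h x)" and vw: "\<And>x. \<psi> (h x) * (star (v x) * w x) = 0"
    by metis
  have ch: "continuous_on UNIV (h x)" for x using h by (simp add: cutoff_def)
  have op: "open {y. 0 < h x y}" for x
    using ch by (intro open_Collect_less continuous_on_const)
  have "0 < h x x" for x using h[of x] by (simp add: cutoff_def)
  then have "UNIV \<subseteq> (\<Union>x\<in>UNIV. {y. 0 < h x y})" by auto
  then obtain X where X: "finite X" "UNIV \<subseteq> (\<Union>x\<in>X. {y. 0 < h x y})"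
    by (rule compactE_image[OF assms(1) op])
  obtain xs where xs: "set xs = X" "distinct xs" using finite_distinct_list[OF X(1)] by blast
  define k where "k = length xs"
  define H where "H y = (\<Sum>l<k. (h (xs ! l) y)\<^sup>2)" for y
  have H: "H y > 0" for y
  proof -
    obtain x where "x \<in> X" "0 < h x y" using X(2) by blast
    then obtain l where "l < k" "0 < h (xs ! l) y" using xs by (metis in_set_conv_nth k_def)
    then show ?thesis unfolding H_def by (intro sum_pos2[of _ l]) auto
  qed
  have cH: "continuous_on UNIV H" unfolding H_def by (intro continuous_intros ch)
  define q where "q y = 1 / H y" for y
  \<comment> \<open>Dividing by \<open>sqrt (H y)\<close> makes the squares of the
    \<open>p l\<close> sum to 1.\<close>
  define p where "p l y = h (xs ! l) y / sqrt (H y)" for l y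
  have cp: "continuous_on UNIV (p l)" for l
    unfolding p_def by (intro continuous_intros ch cH) (use H in \<open>simp add: less_imp_neq[THEN not_sym]\<close>)
  have cq: "continuous_on UNIV q"
    unfolding q_def by (intro continuous_intros cH) (use H in \<open>simp add: less_imp_neq[THEN not_sym]\<close>)
  \<comment> \<open>One factor \<open>h (xs ! l)\<close> is split off from the square of
    \<open>p l\<close>, because the local relations hold only after multiplication by it.\<close>
  have pp: "\<psi> (p l) * \<psi> (p l) = \<psi> (\<lambda>y. q y * h (xs ! l) y) * \<psi> (h (xs ! l))" for l
  proof -
    have "(\<lambda>y. p l y * p l y) = (\<lambda>y. q y * h (xs ! l) y * h (xs ! l) y)"
      using H by (auto simp: p_def q_def less_imp_le)
    then show ?thesis
      using psi_mult[OF cp cp, of l l]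
        psi_mult[OF continuous_on_mult[OF cq ch] ch, of "xs ! l" "xs ! l"] by simp
  qed
  have sum1: "(\<Sum>l<k. \<psi> (p l) * \<psi> (p l)) = 1"
  proof -
    have "(\<Sum>l<k. p l y * p l y) = 1" for y
    proof -
      have "(\<Sum>l<k. p l y * p l y) = (\<Sum>l<k. (h (xs ! l) y)\<^sup>2 / H y)"
        using H[of y] by (intro sum.cong refl) (simp add: p_def power2_eq_square less_imp_le)
      then show ?thesis using H[of y] by (simp add: sum_divide_distrib[symmetric] H_def[symmetric])
    qed
    then have "1 = \<psi> (\<lambda>y. \<Sum>l<k. p l y * p l y)" by (simp add: psi_one)
    also have "\<dots> = (\<Sum>l<k. \<psi> (p l) * \<psi> (p l))"
      using psi_sum[of "{..<k}" "\<lambda>l y. p l y * p l y"] cp by (simp add: psi_mult continuous_on_mult)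
    finally show ?thesis by simp
  qed
  define W where "W l j = \<psi> (p l) * (v (xs ! l) ^ j * w (xs ! l))" for l j
  have "star (W l i) * W l j = (if i = j then \<psi> (p l) * \<psi> (p l) else 0)" for l i j
  proof -
    let ?x = "xs ! l"
    have "star (W l i) * W l j
        = \<psi> (p l) * \<psi> (p l) * (star (v ?x ^ i * w ?x) * (v ?x ^ j * w ?x))"
      unfolding W_def by (rule star_psi_mult_psi[OF cp])
    also have "\<dots> = \<psi> (\<lambda>y. q y * h ?x y) * (if i = j then \<psi> (h ?x) else 0)"
      unfolding pp mult.assoc[of "\<psi> _" "\<psi> _"]
        local_isometry_words[OF psi_central[OF ch] star_psi[OF ch] vv ww vw] ..
    finally show ?thesis by (simp add: pp)
  qed
  then have "(\<Sum>l<k. star (W l i) * W l j) = (if i = j then 1 else 0)" for i j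
    by (simp add: sum1)
  \<comment> \<open>\<open>undefined\<close> serves as some point of the space; for
    \<open>k = 0\<close> the sum \<open>H\<close> would be empty and hence not positive
    there.\<close>
  moreover have "k \<ge> 1" using H[of undefined] unfolding H_def by (cases k) auto
  ultimately show ?thesis using that by blast
qed

end

section \<open>Matrices\<close>

lemma mat_mult_assoc: "mat_mult n (mat_mult n A B) C = mat_mult n A (mat_mult n B C)"
proof (intro ext)
  fix i j
  have "(\<Sum>l<n. (\<Sum>m<n. A i m * B m l) * C l j) = (\<Sum>l<n. \<Sum>m<n. A i m * (B m l * C l j))"
    by (simp add: sum_distrib_right mult.assoc)
  also have "\<dots> = (\<Sum>m<n. A i m * (\<Sum>l<n. B m l * C l j))"
    by (subst sum.swap) (simp add: sum_distrib_left)
  finally show "mat_mult n (mat_mult n A B) C i j = mat_mult n A (mat_mult n B C) i j"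
    by (simp add: mat_mult_def)
qed

lemma mat_eq_mult_left: "mat_eq n B C \<Longrightarrow> mat_eq n (mat_mult n A B) (mat_mult n A C)"
  by (auto simp: mat_eq_def mat_mult_def intro!: sum.cong)

lemma mat_eq_mult_right: "mat_eq n B C \<Longrightarrow> mat_eq n (mat_mult n B A) (mat_mult n C A)"
  by (auto simp: mat_eq_def mat_mult_def intro!: sum.cong)

lemma mat_mult_one_left: "mat_eq n (mat_mult n mat_one A) A"
  by (auto simp: mat_eq_def mat_mult_def mat_one_def if_distrib[of "\<lambda>x. x * _"] cong: if_cong)

lemma mat_mult_zero: "mat_mult n A mat_zero = mat_zero" "mat_mult n mat_zero A = mat_zero"
  by (simp_all add: mat_mult_def mat_zero_def)

lemma mat_eq_trans: "mat_eq n A B \<Longrightarrow> mat_eq n B C \<Longrightarrow> mat_eq n A C"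
  by (simp add: mat_eq_def)

lemma star_sum: "star (\<Sum>i\<in>I. f i) = (\<Sum>i\<in>I. star (f i :: 'a::cstar_algebra))"
  by (rule bounded_linear.linear[OF bounded_linear_star, THEN linear_sum])

lemma range_projection_selfadjoint: "mat_star (mat_mult n v (mat_star v)) = mat_mult n v (mat_star v)"
  by (simp add: mat_star_def mat_mult_def star_sum star_mult star_star)

lemma range_projection_idempotent:
  assumes "mat_eq n (mat_mult n (mat_star v) v) mat_one"
  shows "mat_eq n (mat_mult n (mat_mult n v (mat_star v)) (mat_mult n v (mat_star v))) (mat_mult n v (mat_star v))"
proof -
  have "mat_mult n (mat_mult n v (mat_star v)) (mat_mult n v (mat_star v))
      = mat_mult n v (mat_mult n (mat_mult n (mat_star v) v) (mat_star v))"
    by (simp add: mat_mult_assoc)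
  then show ?thesis
    using mat_eq_mult_left[OF mat_eq_trans[OF mat_eq_mult_right[OF assms] mat_mult_one_left]] by metis
qed

lemma range_projections_orthogonal:
  assumes "mat_eq n (mat_mult n (mat_star v) w) mat_zero"
  shows "mat_eq n (mat_mult n (mat_mult n v (mat_star v)) (mat_mult n w (mat_star w))) mat_zero"
proof -
  have "mat_mult n (mat_mult n v (mat_star v)) (mat_mult n w (mat_star w))
      = mat_mult n v (mat_mult n (mat_mult n (mat_star v) w) (mat_star w))"
    by (simp add: mat_mult_assoc)
  then show ?thesis
    using mat_eq_mult_left[OF mat_eq_mult_right[OF assms]] by (metis mat_mult_zero)
qed

text \<open>The required projections are the range projections of \<open>v\<close> and
  \<open>w\<close>, so it suffices to find two isometries with orthogonal ranges.\<close>

lemma mat_properly_infiniteI: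
  fixes v w :: "nat \<Rightarrow> nat \<Rightarrow> 'a::cstar_algebra"
  assumes "mat_eq n (mat_mult n (mat_star v) v) mat_one" "mat_eq n (mat_mult n (mat_star w) w) mat_one"
    and "mat_eq n (mat_mult n (mat_star v) w) mat_zero"
  shows "mat_properly_infinite n TYPE('a)"
  unfolding mat_properly_infinite_def
  by (rule exI[of _ "mat_mult n v (mat_star v)"], rule exI[of _ "mat_mult n w (mat_star w)"],
      rule exI[of _ v], rule exI[of _ w])
     (simp add: assms range_projection_selfadjoint range_projection_idempotent
       range_projections_orthogonal, simp add: mat_eq_def)

theorem theorem2p11:
  fixes \<phi> :: "('x::t2_space \<Rightarrow> complex) \<Rightarrow> 'a::cstar_algebra"
  assumes "compact (UNIV :: 'x set)"
    and "CX_algebra \<phi>"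
    and "\<forall>x. fibre_properly_infinite \<phi> x"
  shows "\<exists>n\<ge>1. mat_properly_infinite n TYPE('a)"
proof -
  interpret CX_alg \<phi> by unfold_locales (rule assms)
  obtain k and W :: "nat \<Rightarrow> nat \<Rightarrow> 'a" where k: "k \<ge> 1"
    and W: "\<And>i j. (\<Sum>l<k. star (W l i) * W l j) = (if i = j then 1 else 0)"
    using global_isometry[OF assms(1,3)] by blast
  \<comment> \<open>The two isometries consist of columns \<open>0\<close> to \<open>k - 1\<close>
    and \<open>k\<close> to \<open>2 * k - 1\<close> of \<open>W\<close>. For \<open>i < k\<close>
    the indices \<open>i\<close> and \<open>k + j\<close> differ, so the cross products
    vanish.\<close>
  have "mat_properly_infinite k TYPE('a)"
    by (rule mat_properly_infiniteI[of k W "\<lambda>l j. W l (k + j)"])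
       (auto simp: mat_eq_def mat_mult_def mat_star_def mat_one_def mat_zero_def W)
  then show ?thesis using k by blast
qed

end
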